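(* Let $1\le n\in\mathbb{N}$, and let $P\subseteq\mathbb{R}^n$ be a nonempty closed perfect subset of $\mathbb{R}^n$. Then there exists a family $\langle C_i:i<2^{\aleph_0}\rangle$ of $2^{\aleph_0}$ pairwise-disjoint closed subsets of $\mathbb{R}^n$ such that $P+C_i=\mathbb{R}^n$ and $C_i+C_j=\mathbb{R}^n$ for all $i,j<2^{\aleph_0}$.
   Context: A closed perfect set is a closed set with no isolated points. For $A,B\subseteq\mathbb{R}^n$, $A+B=\{a+b:a\in A,\ b\in B\}$. The case $i=j$ is included in the conclusion. *)

theory Defs
  imports "HOL-Analysis.Analysis"
begin

definition closed_perfect :: "'a::topological_space set \<Rightarrow> bool" where
  "closed_perfect P \<longleftrightarrow> closed P \<and> \<not> (\<exists>x. x isolated_in P)"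

end

theory Submission
  imports Defs
begin

text \<open>Some coordinate is non-constant on every relatively open piece of a suitable portion of \<open>P\<close>,
  so projecting to it reduces the problem to a compact set \<open>K\<close> of reals without isolated points.
  There one chooses rapidly growing \<open>t k\<close> such that multiplying by \<open>t (Suc k)\<close> makes \<open>K\<close>, even
  locally near each of its points at scale \<open>1 / t k\<close>, almost dense modulo 24. The set with index
  \<open>i\<close> consists of the \<open>z\<close> such that for all \<open>k\<close> the number \<open>t k * z\<close> lies within 3/4 of an integer
  whose residue modulo 24 belongs to a set \<open>S (k \<in> i)\<close>, where \<open>S True\<close> and \<open>S False\<close> contain no
  equal or adjacent residues (whence disjointness), but any two of them, equal or not, add up to
  all residues. For both sum conditions, the constraints are then met one \<open>k\<close> at a time, each
  correction being too small to spoil the previous ones.\<close>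

section \<open>Density of dilates modulo 1 and modulo \<open>N\<close>\<close>

text \<open>While \<open>s\<close> runs through an interval of length
  \<open>1 / \<bar>v\<bar>\<close>, the product \<open>s * v\<close> sweeps an interval of length 1
  and so meets every residue modulo 1.\<close>

lemma exists_shift_in_interval:
  fixes v c T :: real
  assumes "v \<noteq> 0"
  shows "\<exists>s m. T \<le> s \<and> s \<le> T + 1 / \<bar>v\<bar> \<and> s * v = c + real_of_int m"
proof -
  define w where "w = \<bar>v\<bar>"
  define e where "e = sgn v"
  have w: "w > 0" and v: "v = e * w" and e: "e = 1 \<or> e = -1"
    using assms by (auto simp: w_def e_def sgn_if)
  define n where "n = \<lceil>T * w - e * c\<rceil>"
  define s where "s = (e * c + real_of_int n) / w"
  have n: "T * w - e * c \<le> n" "n < T * w - e * c + 1"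
    unfolding n_def by linarith+
  have "T \<le> s"
    using n w by (simp add: s_def pos_le_divide_eq)
  moreover have "s \<le> T + 1 / w"
    using n w by (simp add: s_def pos_divide_le_eq distrib_right)
  moreover have "s * w = e * c + n"
    using w by (simp add: s_def)
  then have "s * v = c + e * n"
    using e by (auto simp: v)
  moreover have "\<exists>m::int. e * n = m"
    using e by (metis mult_1 mult_minus1 of_int_minus)
  ultimately show ?thesis
    using w_def by auto
qed

text \<open>Induction on \<open>I\<close>, each new point being taken much closer to its limit than the previous
  ones: as \<open>t\<close> grows, \<open>t * (q l - p l)\<close> then stays near its target modulo 1 long enough for the
  previously treated indices to be served as well.\<close>

lemma simultaneous_approximation_near_limit_points:
  fixes K :: "real set" and p c :: "'i \<Rightarrow> real"
  assumes "finite I" and "\<And>l. l \<in> I \<Longrightarrow> p l islimpt K" and "\<epsilon> > 0" and "\<eta> > 0"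
  shows "\<exists>q L. L > 0 \<and> (\<forall>l\<in>I. q l \<in> K \<and> \<bar>q l - p l\<bar> < \<eta>) \<and>
    (\<forall>T. \<exists>t\<ge>T. t \<le> T + L \<and> (\<forall>l\<in>I. \<exists>m::int. \<bar>t * (q l - p l) - c l - m\<bar> \<le> \<epsilon>))"
  using assms(1,2)
proof (induction I rule: finite_induct)
  case empty
  show ?case
    by (intro exI[of _ p] exI[of _ 1]) force+
next
  case (insert l I)
  then obtain q L where L: "L > 0" and q: "\<forall>l\<in>I. q l \<in> K \<and> \<bar>q l - p l\<bar> < \<eta>"
    and t: "\<And>T. \<exists>t\<ge>T. t \<le> T + L \<and> (\<forall>l\<in>I. \<exists>m::int. \<bar>t * (q l - p l) - c l - m\<bar> \<le> \<epsilon>)"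
    by (metis insertI2)
  \<comment> \<open>The waiting time \<open>L\<close> for the old indices is fixed before
    \<open>r\<close> is chosen, so \<open>t * (r - p l)\<close> can be made to drift by at most
    \<open>\<epsilon>\<close> during a time \<open>L\<close>.\<close>
  have "min \<eta> (\<epsilon> / L) > 0"
    using L assms by simp
  then obtain r where r: "r \<in> K" "r \<noteq> p l" "dist r (p l) < min \<eta> (\<epsilon> / L)"
    using insert.prems[of l] unfolding islimpt_approachable by blast
  define v where "v = r - p l"
  have v: "v \<noteq> 0" "\<bar>v\<bar> < \<eta>" "\<bar>v\<bar> < \<epsilon> / L"
    using r by (auto simp: v_def dist_real_def)
  define q' where "q' = q(l := r)"
  \<comment> \<open>First wait at most \<open>1 / \<bar>v\<bar>\<close> until the new index hits its
    target exactly, then at most \<open>L\<close> more for the old ones.\<close>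
  have "\<exists>t\<ge>T. t \<le> T + (1 / \<bar>v\<bar> + L) \<and>
      (\<forall>l\<in>insert l I. \<exists>m::int. \<bar>t * (q' l - p l) - c l - m\<bar> \<le> \<epsilon>)" for T
  proof -
    obtain s m where s: "T \<le> s" "s \<le> T + 1 / \<bar>v\<bar>" "s * v = c l + real_of_int m"
      using exists_shift_in_interval[OF v(1)] by blast
    obtain t where t: "s \<le> t" "t \<le> s + L"
      "\<forall>l\<in>I. \<exists>m::int. \<bar>t * (q l - p l) - c l - m\<bar> \<le> \<epsilon>"
      using t by blast
    have "t * v - c l - m = (t - s) * v"
      using s(3) by (simp add: algebra_simps)
    then have "\<bar>t * v - c l - m\<bar> = (t - s) * \<bar>v\<bar>"
      using t by (simp add: abs_mult)
    also have "\<dots> \<le> L * (\<epsilon> / L)"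
      using t v L by (intro mult_mono) auto
    also have "\<dots> = \<epsilon>"
      using L by simp
    finally have "\<bar>t * (q' l - p l) - c l - m\<bar> \<le> \<epsilon>"
      by (simp add: q'_def v_def)
    moreover have "\<forall>l\<in>I. q' l = q l"
      using insert.hyps by (auto simp: q'_def)
    ultimately show ?thesis
      using s t by (intro exI[of _ t]) auto
  qed
  moreover have "1 / \<bar>v\<bar> + L > 0"
    using v L by (simp add: add_pos_pos)
  moreover have "\<forall>l\<in>insert l I. q' l \<in> K \<and> \<bar>q' l - p l\<bar> < \<eta>"
    using q r by (auto simp: q'_def dist_real_def)
  ultimately show ?case
    by blast
qed

lemma finite_ball_cover:
  fixes K :: "'a::metric_space set"
  assumes "compact K" and "\<epsilon> > 0"
  obtains F where "F \<subseteq> K" and "finite F" and "K \<subseteq> (\<Union>f\<in>F. ball f \<epsilon>)"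
proof (rule compactE_image[OF \<open>compact K\<close>])
  show "K \<subseteq> (\<Union>f\<in>K. ball f \<epsilon>)"
    using \<open>\<epsilon> > 0\<close> by auto
qed (use that in auto)

lemma finite_net_mod_1:
  fixes \<epsilon> :: real
  assumes "\<epsilon> > 0"
  shows "\<exists>J. finite J \<and> (\<forall>y. \<exists>c\<in>J. \<exists>m::int. \<bar>y - c - m\<bar> \<le> \<epsilon>)"
proof -
  obtain J :: "real set" where "J \<subseteq> {0..1}"
    and J: "finite J" "{0..1} \<subseteq> (\<Union>c\<in>J. ball c \<epsilon>)"
    by (rule finite_ball_cover[OF compact_Icc assms])
  have "\<exists>c\<in>J. \<exists>m::int. \<bar>y - c - m\<bar> \<le> \<epsilon>" for y
  proof -
    have "frac y \<in> {0..1}"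
      by (simp add: less_imp_le frac_lt_1)
    then have "frac y \<in> (\<Union>c\<in>J. ball c \<epsilon>)"
      using J by blast
    then obtain c where c: "c \<in> J" "\<bar>c - frac y\<bar> < \<epsilon>"
      by (auto simp: dist_real_def)
    then have "\<bar>y - c - \<lfloor>y\<rfloor>\<bar> \<le> \<epsilon>"
      unfolding frac_def by linarith
    with c show ?thesis by blast
  qed
  with J show ?thesis by blast
qed

text \<open>Compactness reduces all pairs of a point and a residue to a finite set
  \<open>F \<times> J\<close>, for which one multiplier \<open>t\<close> works
  simultaneously.\<close>

lemma uniform_density_mod_1:
  fixes K :: "real set"
  assumes "compact K" and lim: "\<And>p. p \<in> K \<Longrightarrow> p islimpt K" and "\<epsilon> > 0" and "\<delta> > 0"
  shows "\<exists>t\<ge>T. \<forall>p\<in>K. \<forall>y. \<exists>q\<in>K. \<bar>q - p\<bar> < \<delta> \<and> (\<exists>m::int. \<bar>t * q - y - m\<bar> \<le> \<epsilon>)"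
proof -
  obtain F where F: "F \<subseteq> K" "finite F" "K \<subseteq> (\<Union>f\<in>F. ball f (\<delta> / 2))"
    using finite_ball_cover[OF \<open>compact K\<close>, of "\<delta> / 2"] \<open>\<delta> > 0\<close> by auto
  obtain J where J: "finite J" "\<And>y. \<exists>c\<in>J. \<exists>m::int. \<bar>y - c - m\<bar> \<le> \<epsilon> / 2"
    using finite_net_mod_1[of "\<epsilon> / 2"] \<open>\<epsilon> > 0\<close> by auto
  have "\<exists>q L. L > 0 \<and> (\<forall>l\<in>F \<times> J. q l \<in> K \<and> \<bar>q l - fst l\<bar> < \<delta> / 2) \<and>
    (\<forall>T. \<exists>t\<ge>T. t \<le> T + L \<and>
      (\<forall>l\<in>F \<times> J. \<exists>m::int. \<bar>t * (q l - fst l) - snd l - m\<bar> \<le> \<epsilon> / 2))"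
    using F J(1) assms by (intro simultaneous_approximation_near_limit_points) auto
  then obtain q t where q: "\<And>l. l \<in> F \<times> J \<Longrightarrow> q l \<in> K \<and> \<bar>q l - fst l\<bar> < \<delta> / 2"
    and t: "t \<ge> T" "\<And>l. l \<in> F \<times> J \<Longrightarrow> \<exists>m::int. \<bar>t * (q l - fst l) - snd l - m\<bar> \<le> \<epsilon> / 2"
    by metis
  have "\<exists>q\<in>K. \<bar>q - p\<bar> < \<delta> \<and> (\<exists>m::int. \<bar>t * q - y - m\<bar> \<le> \<epsilon>)" if "p \<in> K" for p y
  proof -
    obtain f where f: "f \<in> F" "dist f p < \<delta> / 2"
      using F \<open>p \<in> K\<close> by fastforce
    \<comment> \<open>The required residue \<open>y - t * f\<close> depends on \<open>t\<close>,
      which is already fixed; this is why every centre \<open>f\<close> was paired with a whole net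
      of residues.\<close>
    obtain c m1 where c: "c \<in> J" "\<bar>(y - t * f) - c - real_of_int m1\<bar> \<le> \<epsilon> / 2"
      using J by blast
    obtain m2 :: int where m2: "\<bar>t * (q (f, c) - f) - c - m2\<bar> \<le> \<epsilon> / 2"
      using t(2)[of "(f, c)"] f c by auto
    have "\<bar>t * q (f, c) - y - of_int (m2 - m1)\<bar> \<le> \<epsilon>"
      using c(2) m2 unfolding of_int_diff right_diff_distrib abs_le_iff by linarith
    moreover have qf: "q (f, c) \<in> K" "\<bar>q (f, c) - f\<bar> < \<delta> / 2"
      using q[of "(f, c)"] f c by auto
    moreover have "\<bar>q (f, c) - p\<bar> < \<delta>"
      using qf(2) f(2) unfolding dist_real_def by linarith
    ultimately show ?thesis by blast
  qed
  with t show ?thesis by blast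
qed

lemma uniform_density_mod:
  fixes K :: "real set" and N :: real
  assumes "compact K" and "\<And>p. p \<in> K \<Longrightarrow> p islimpt K" and "\<epsilon> > 0" and "\<delta> > 0" and N: "N > 0"
  shows "\<exists>t\<ge>T. \<forall>p\<in>K. \<forall>y. \<exists>q\<in>K. \<bar>q - p\<bar> < \<delta> \<and> (\<exists>m::int. \<bar>t * q - y - N * real_of_int m\<bar> \<le> \<epsilon>)"
proof -
  obtain t where t: "t \<ge> T / N"
    "\<And>p y. p \<in> K \<Longrightarrow> \<exists>q\<in>K. \<bar>q - p\<bar> < \<delta> \<and> (\<exists>m::int. \<bar>t * q - y - m\<bar> \<le> \<epsilon> / N)"
    using uniform_density_mod_1[of K "\<epsilon> / N" \<delta> "T / N"] assms by auto
  have "\<exists>q\<in>K. \<bar>q - p\<bar> < \<delta> \<and> (\<exists>m::int. \<bar>N * t * q - y - N * real_of_int m\<bar> \<le> \<epsilon>)" if "p \<in> K" for p y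
  proof -
    obtain q and m :: int where q: "q \<in> K" "\<bar>q - p\<bar> < \<delta>" "\<bar>t * q - y / N - m\<bar> \<le> \<epsilon> / N"
      using t(2)[OF \<open>p \<in> K\<close>] by blast
    have "N * t * q - y - N * m = N * (t * q - y / N - m)"
      using N by (simp add: algebra_simps)
    then have "\<bar>N * t * q - y - N * real_of_int m\<bar> = N * \<bar>t * q - y / N - m\<bar>"
      using N by (simp add: abs_mult)
    also have "\<dots> \<le> \<epsilon>"
      using q(3) N by (simp add: field_simps)
    finally show ?thesis using q by blast
  qed
  moreover have "N * t \<ge> T"
    using t(1) N by (simp add: field_simps)
  ultimately show ?thesis by blast
qed

section \<open>Limits of successive corrections\<close>

text \<open>Since \<open>r / t k\<close> at least halves at each step, the corrections made from
  stage \<open>k\<close> on total at most \<open>r / t k\<close>. At scale \<open>t k\<close>, where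
  the constraint of stage \<open>k\<close> is measured, they cost at most \<open>r\<close>.\<close>

lemma geometric_steps_converge:
  fixes q t :: "nat \<Rightarrow> real"
  assumes pos: "\<And>k. t k > 0" and grow: "\<And>k. t (Suc k) \<ge> 2 * t k" and "r > 0"
    and step: "\<And>k. \<bar>q (Suc k) - q k\<bar> \<le> r / (2 * t k)"
  obtains z where "q \<longlonglongrightarrow> z" and "\<And>k. \<bar>t k * z - t k * q k\<bar> \<le> r"
proof -
  have decay: "r / t (Suc k) \<le> r / t k / 2" for k
  proof -
    have "r / t (Suc k) \<le> r / (2 * t k)"
      using pos[of k] pos[of "Suc k"] grow[of k] \<open>r > 0\<close> by (intro divide_left_mono) auto
    then show ?thesis by simp
  qed
  \<comment> \<open>Subtracting \<open>r / t (k + n)\<close> makes the induction close: one step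
    costs at most half of this term, which is what the term loses when \<open>n\<close>
    increases.\<close>
  have near: "\<bar>q (k + n) - q k\<bar> \<le> r / t k - r / t (k + n)" for k n
  proof (induction n)
    case (Suc n)
    have "r / (2 * t (k + n)) = r / t (k + n) / 2"
      by simp
    then have "\<bar>q (k + Suc n) - q (k + n)\<bar> \<le> r / t (k + n) / 2"
      using step[of "k + n"] by simp
    then show ?case
      using Suc decay[of "k + n"] unfolding add_Suc_right by linarith
  qed simp
  have near': "\<bar>q (k + n) - q k\<bar> \<le> r / t k" for k n
  proof -
    have "r / t (k + n) \<ge> 0"
      using pos[of "k + n"] \<open>r > 0\<close> by simp
    with near[of k n] show ?thesis by linarith
  qed
  have small: "r / t k \<le> r / t 0 * (1 / 2) ^ k" for k
  proof (induction k)
    case (Suc k)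
    show ?case
      using order_trans[OF decay[of k] divide_right_mono[OF Suc, of 2]] by simp
  qed simp
  have "(\<lambda>k. r / t 0 * (1 / 2) ^ k) \<longlonglongrightarrow> r / t 0 * 0"
    by (intro tendsto_mult_left LIMSEQ_power_zero) simp
  then have lim0: "(\<lambda>k. r / t 0 * (1 / 2) ^ k) \<longlonglongrightarrow> 0"
    by simp
  have "Cauchy q"
  proof (rule metric_CauchyI)
    fix e :: real assume "e > 0"
    then obtain k where k: "r / t 0 * (1 / 2) ^ k < e / 2"
      using order_tendstoD(2)[OF lim0, of "e / 2"] by (auto simp: eventually_sequentially)
    have "dist (q m) (q k) < e / 2" if "m \<ge> k" for m
    proof -
      have "\<bar>q m - q k\<bar> \<le> r / t k"
        using near'[of k "m - k"] that by simp
      then show ?thesis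
        using small[of k] k unfolding dist_real_def by linarith
    qed
    then show "\<exists>M. \<forall>m\<ge>M. \<forall>n\<ge>M. dist (q m) (q n) < e"
      by (metis dist_triangle_half_l)
  qed
  then obtain z where z: "q \<longlonglongrightarrow> z"
    by (auto simp: Cauchy_convergent_iff convergent_def)
  have "\<bar>t k * z - t k * q k\<bar> \<le> r" for k
  proof -
    have "(\<lambda>n. q (k + n)) \<longlonglongrightarrow> z"
      using LIMSEQ_ignore_initial_segment[OF z, of k] by (simp add: add.commute)
    then have "(\<lambda>n. \<bar>q (k + n) - q k\<bar>) \<longlonglongrightarrow> \<bar>z - q k\<bar>"
      by (intro tendsto_intros)
    then have "\<bar>z - q k\<bar> \<le> r / t k"
      by (rule LIMSEQ_le_const2) (use near' in blast)
    then have "t k * \<bar>z - q k\<bar> \<le> r"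
      using pos[of k] by (simp add: field_simps)
    moreover have "\<bar>t k * z - t k * q k\<bar> = t k * \<bar>z - q k\<bar>"
      using pos[of k] by (simp add: abs_mult flip: right_diff_distrib)
    ultimately show ?thesis by simp
  qed
  with z that show thesis by blast
qed

section \<open>Digit sets modulo 24\<close>

text \<open>Residues modulo 24, found by computer search.\<close>

definition digit_set :: "bool \<Rightarrow> int set" where
  "digit_set b = (if b then {2, 6, 7, 8, 9, 13, 14, 15, 16} else {0, 4, 11, 18, 19, 20, 21, 22, 23})"

text \<open>Integers closer than 2 have equal or cyclically adjacent residues, which evaluation
  rules out. A gap of 2 keeps intervals of radius 3/4 around such integers disjoint.\<close>

lemma digit_set_separated:
  assumes "a mod 24 \<in> digit_set True" and "b mod 24 \<in> digit_set False"
  shows "\<bar>a - b\<bar> \<ge> 2"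
proof (rule ccontr)
  assume "\<not> ?thesis"
  then have "a = b \<or> a = b + 1 \<or> a = b - 1" by linarith
  then have "a mod 24 = b mod 24 \<or> a mod 24 = (b mod 24 + 1) mod 24 \<or> (a mod 24 + 1) mod 24 = b mod 24"
    by (auto simp: mod_add_left_eq)
  moreover have "\<forall>x\<in>digit_set True. \<forall>y\<in>digit_set False. x \<noteq> y \<and> x \<noteq> (y + 1) mod 24 \<and> (x + 1) mod 24 \<noteq> y"
    by code_simp
  ultimately show False
    using assms by blast
qed

text \<open>A finite check. The case \<open>c = d\<close> matters even for distinct indices, which
  may still agree at some levels.\<close>

lemma digit_set_sums:
  "\<exists>a\<in>digit_set c. \<exists>b\<in>digit_set d. (a + b) mod 24 = s mod 24"
proof -
  have "\<forall>c d. \<forall>s\<in>{0..23::int}. \<exists>a\<in>digit_set c. \<exists>b\<in>digit_set d. (a + b) mod 24 = s"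
    by code_simp
  moreover have "s mod 24 \<in> {0..23}"
    by simp
  ultimately show ?thesis by blast
qed

lemma digit_set_mod:
  assumes "a \<in> digit_set b"
  shows "a mod 24 = a"
proof -
  have "\<forall>b. \<forall>a\<in>digit_set b. a mod 24 = a"
    by code_simp
  with assms show ?thesis by blast
qed

section \<open>The disjoint family on the real line\<close>

text \<open>Iterates \<open>uniform_density_mod\<close> with \<open>N = 24\<close>. The distance
  \<open>1 / (8 * t k)\<close> is the step allowed by \<open>geometric_steps_converge\<close> for
  \<open>r = 1 / 4\<close>; the factor 200 makes a shift by 24 at scale \<open>t (Suc k)\<close> no
  larger, as 24/200 < 1/8.\<close>

lemma rapid_density_sequence:
  fixes K :: "real set"
  assumes "compact K" and "\<And>p. p \<in> K \<Longrightarrow> p islimpt K"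
  obtains t :: "nat \<Rightarrow> real" where "\<And>k. t k \<ge> 1" and "\<And>k. t (Suc k) \<ge> 200 * t k"
    and "\<And>k p y. p \<in> K \<Longrightarrow>
      \<exists>q\<in>K. \<bar>q - p\<bar> \<le> 1 / (8 * t k) \<and> (\<exists>m::int. \<bar>t (Suc k) * q - y - 24 * real_of_int m\<bar> \<le> 1 / 4)"
    and "\<And>p y. p \<in> K \<Longrightarrow> \<exists>q\<in>K. \<exists>m::int. \<bar>t 0 * q - y - 24 * real_of_int m\<bar> \<le> 1 / 4"
proof -
  have density: "\<exists>t\<ge>T. \<forall>p\<in>K. \<forall>y. \<exists>q\<in>K. \<bar>q - p\<bar> < \<delta> \<and> (\<exists>m::int. \<bar>t * q - y - 24 * real_of_int m\<bar> \<le> 1 / 4)"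
    if "\<delta> > 0" for T \<delta>
    by (rule uniform_density_mod) (use assms that in auto)
  obtain t0 where t0: "t0 \<ge> 1"
    "\<And>p y. p \<in> K \<Longrightarrow> \<exists>q\<in>K. \<exists>m::int. \<bar>t0 * q - y - 24 * real_of_int m\<bar> \<le> 1 / 4"
    using density[of 1 1] by fastforce
  define R where "R a b \<longleftrightarrow> b \<ge> 200 * a \<and> (\<forall>p\<in>K. \<forall>y. \<exists>q\<in>K. \<bar>q - p\<bar> \<le> 1 / (8 * a) \<and>
      (\<exists>m::int. \<bar>b * q - y - 24 * real_of_int m\<bar> \<le> 1 / 4))" for a b :: real
  have "\<exists>t. t 0 = t0 \<and> (\<forall>k. t k \<ge> 1 \<and> R (t k) (t (Suc k)))"
  proof -
    have "\<exists>b\<ge>1. R a b" if "a \<ge> 1" for a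
    proof -
      have "1 / (8 * a) > 0" using that by simp
      from density[OF this, of "200 * a"] obtain b where b: "b \<ge> 200 * a"
        "\<forall>p\<in>K. \<forall>y. \<exists>q\<in>K. \<bar>q - p\<bar> < 1 / (8 * a) \<and> (\<exists>m::int. \<bar>b * q - y - 24 * real_of_int m\<bar> \<le> 1 / 4)"
        by blast
      then have "R a b"
        unfolding R_def by (meson less_imp_le)
      with b that show ?thesis by (intro exI[of _ b]) auto
    qed
    then obtain g where g: "\<And>a. a \<ge> 1 \<Longrightarrow> g a \<ge> 1 \<and> R a (g a)" by metis
    define t where "t = rec_nat t0 (\<lambda>_. g)"
    have "t k \<ge> 1" for k
      by (induction k) (use t0 g in \<open>auto simp: t_def\<close>)
    then show ?thesis
      by (intro exI[of _ t]) (use g in \<open>auto simp: t_def\<close>)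
  qed
  then obtain t where "t 0 = t0" "\<And>k. t k \<ge> 1" "\<And>k. R (t k) (t (Suc k))" by blast
  with t0 that show thesis
    unfolding R_def by metis
qed

lemma real_disjoint_family:
  fixes K :: "real set"
  assumes "compact K" and "K \<noteq> {}" and "\<And>p. p \<in> K \<Longrightarrow> p islimpt K"
  obtains D :: "nat set \<Rightarrow> real set" where "disjoint_family D" and "\<And>i. closed (D i)"
    and "\<And>x i. \<exists>p\<in>K. x - p \<in> D i" and "\<And>x i j. \<exists>y\<in>D i. x - y \<in> D j"
proof -
  obtain t where t1: "\<And>k. t k \<ge> 1" and grow: "\<And>k. t (Suc k) \<ge> 200 * t k"
    and tS: "\<And>k p y. p \<in> K \<Longrightarrow>
      \<exists>q\<in>K. \<bar>q - p\<bar> \<le> 1 / (8 * t k) \<and> (\<exists>m::int. \<bar>t (Suc k) * q - y - 24 * real_of_int m\<bar> \<le> 1 / 4)"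
    and t0: "\<And>p y. p \<in> K \<Longrightarrow> \<exists>q\<in>K. \<exists>m::int. \<bar>t 0 * q - y - 24 * real_of_int m\<bar> \<le> 1 / 4"
    using rapid_density_sequence[of K] assms by blast
  have tpos: "t k > 0" for k
    using t1[of k] by linarith
  have t2: "t (Suc k) \<ge> 2 * t k" for k
    using grow[of k] tpos[of k] by linarith
  \<comment> \<open>The radius 3/4 is the error budget: 1/4 for the limit process plus up to 1/2 for
    rounding \<open>t k * x\<close>. The sum with \<open>K\<close> uses only 1/4 + 1/4.\<close>
  define A where "A b = (\<Union>a\<in>{a::int. a mod 24 \<in> digit_set b}. cball (real_of_int a) (3 / 4))" for b
  define D where "D i = (\<Inter>k. (\<lambda>z. t k * z) -` A (k \<in> i))" for i :: "nat set"
  have A_I: "z \<in> A b" if "a mod 24 \<in> digit_set b" "\<bar>z - real_of_int a\<bar> \<le> 3 / 4" for a b z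
    using that by (auto simp: A_def dist_real_def abs_minus_commute)
  have closed_A: "closed (A b)" for b
  proof -
    let ?S = "real_of_int ` {a. a mod 24 \<in> digit_set b}"
    \<comment> \<open>The union of balls is infinite, so it is rewritten as the sum of a closed set
      of integers and a compact ball.\<close>
    have "(\<Union>y\<in>cball 0 (3 / 4). {x + y}) = cball x (3 / 4)" for x :: real
      using image_add_cball[of x 0 "3 / 4"] by (simp add: UNION_singleton_eq_range)
    then have "A b = (\<Union>x\<in>?S. \<Union>y\<in>cball 0 (3 / 4). {x + y})"
      by (simp add: A_def)
    moreover have "closed ?S"
      by (rule closed_subset_Ints) auto
    ultimately show ?thesis
      using closed_compact_sums[OF _ compact_cball] by metis
  qed
  have closed_D: "closed (D i)" for i
    unfolding D_def by (intro closed_INT ballI closed_vimage closed_A continuous_intros)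
  have disj_A: "A True \<inter> A False = {}"
  proof -
    have False if "z \<in> cball (real_of_int a) (3 / 4)" "z \<in> cball (real_of_int b) (3 / 4)"
      "a mod 24 \<in> digit_set True" "b mod 24 \<in> digit_set False" for a b z
    proof -
      have "\<bar>real_of_int a - real_of_int b\<bar> < 2"
        using that unfolding mem_cball dist_real_def by linarith
      then have "\<bar>a - b\<bar> < 2" by linarith
      with digit_set_separated that show False by fastforce
    qed
    then show ?thesis unfolding A_def by blast
  qed
  have disj: "disjoint_family D"
    unfolding disjoint_family_on_def
  proof (intro ballI impI equals0I)
    fix i j z assume "i \<noteq> j" and z: "z \<in> D i \<inter> D j"
    then obtain k where "(k \<in> i) \<noteq> (k \<in> j)" by auto
    moreover have "t k * z \<in> A (k \<in> i)" "t k * z \<in> A (k \<in> j)"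
      using z by (auto simp: D_def)
    ultimately show False
      using disj_A by (cases "k \<in> i") auto
  qed
  have "\<exists>p\<in>K. x - p \<in> D i" for x i
  proof -
    \<comment> \<open>One digit per level is enough here, because the points of \<open>K\<close> can
      realise any residue modulo 24; 2 and 0 are arbitrary members of the two digit sets.\<close>
    define s :: "nat \<Rightarrow> int" where "s k = (if k \<in> i then 2 else 0)" for k
    have s: "s k \<in> digit_set (k \<in> i)" for k
      by (simp add: s_def digit_set_def)
    let ?near = "\<lambda>k q. \<exists>m::int. \<bar>t k * q - (t k * x - s k) - 24 * real_of_int m\<bar> \<le> 1 / 4"
    obtain p where p: "\<And>k. p k \<in> K \<and> ?near k (p k)"
      "\<And>k. \<bar>p (Suc k) - p k\<bar> \<le> 1 / (8 * t k)"
    proof -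
      have "\<exists>p. \<forall>k. (p k \<in> K \<and> ?near k (p k)) \<and> \<bar>p (Suc k) - p k\<bar> \<le> 1 / (8 * t k)"
      proof (rule dependent_nat_choice)
        show "\<exists>q. q \<in> K \<and> ?near 0 q"
          using t0 assms(2) by blast
        show "\<exists>q. (q \<in> K \<and> ?near (Suc k) q) \<and> \<bar>q - p\<bar> \<le> 1 / (8 * t k)"
          if "p \<in> K \<and> ?near k p" for p k
          using tS that by blast
      qed
      with that show thesis by blast
    qed
    obtain q where q: "p \<longlonglongrightarrow> q" "\<And>k. \<bar>t k * q - t k * p k\<bar> \<le> 1 / 4"
      using geometric_steps_converge[of t "1 / 4" p] tpos t2 p(2) by auto
    have "q \<in> K"
      using closed_sequentially[OF compact_imp_closed[OF assms(1)], of p q] q(1) p(1) by simp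
    moreover have "t k * (x - q) \<in> A (k \<in> i)" for k
    proof -
      obtain m :: int where m: "\<bar>t k * p k - (t k * x - s k) - 24 * real_of_int m\<bar> \<le> 1 / 4"
        using p by blast
      have "\<bar>t k * (x - q) - real_of_int (s k - 24 * m)\<bar> \<le> 3 / 4"
        using m q(2)[of k] unfolding right_diff_distrib of_int_diff of_int_mult of_int_numeral by linarith
      moreover have "(s k - 24 * m) mod 24 = s k"
        using digit_set_mod[OF s[of k]] by (metis mod_mult_self2 minus_mult_right diff_conv_add_uminus)
      ultimately show ?thesis
        using s[of k] by (intro A_I[of "s k - 24 * m"]) auto
    qed
    ultimately show ?thesis
      by (auto simp: D_def)
  qed
  moreover have "\<exists>y\<in>D i. x - y \<in> D j" for x i j
  proof -
    obtain \<alpha> \<beta> where \<alpha>\<beta>: "\<And>c d s. \<alpha> c d s \<in> digit_set c \<and> \<beta> c d s \<in> digit_set d \<and>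
        (\<alpha> c d s + \<beta> c d s) mod 24 = s mod 24"
      using digit_set_sums by metis
    \<comment> \<open>The digits split the rounded value of \<open>t k * x\<close>. Only
      \<open>y\<close> is built, from the digits \<open>a k\<close>; \<open>x - y\<close> then has
      the digits \<open>b k\<close>.\<close>
    define a where "a k = \<alpha> (k \<in> i) (k \<in> j) (round (t k * x))" for k
    define b where "b k = \<beta> (k \<in> i) (k \<in> j) (round (t k * x))" for k
    have a: "a k \<in> digit_set (k \<in> i)" and b: "b k \<in> digit_set (k \<in> j)"
      and ab: "(a k + b k) mod 24 = round (t k * x) mod 24" for k
      using \<alpha>\<beta> by (simp_all add: a_def b_def)
    let ?hit = "\<lambda>k y. \<exists>m::int. t k * y = a k + 24 * real_of_int m"
    obtain y where y: "\<And>k. ?hit k (y k)" "\<And>k. \<bar>y (Suc k) - y k\<bar> \<le> 1 / (8 * t k)"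
    proof -
      have "\<exists>y. \<forall>k. ?hit k (y k) \<and> \<bar>y (Suc k) - y k\<bar> \<le> 1 / (8 * t k)"
      proof (rule dependent_nat_choice)
        show "\<exists>y. ?hit 0 y"
          using tpos[of 0] by (intro exI[of _ "a 0 / t 0"] exI[of _ 0]) simp
        fix y k
        \<comment> \<open>The largest number in the class of \<open>a (Suc k)\<close> modulo 24 not
          exceeding \<open>t (Suc k) * y\<close> is less than 24 away from it.\<close>
        define m where "m = \<lfloor>(t (Suc k) * y - a (Suc k)) / 24\<rfloor>"
        define y' where "y' = (a (Suc k) + 24 * real_of_int m) / t (Suc k)"
        have eq: "t (Suc k) * y' = a (Suc k) + 24 * real_of_int m"
          using tpos[of "Suc k"] by (simp add: y'_def)
        have "\<bar>t (Suc k) * y' - t (Suc k) * y\<bar> \<le> 24"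
        proof -
          define w where "w = (t (Suc k) * y - a (Suc k)) / 24"
          have "t (Suc k) * y = a (Suc k) + 24 * w"
            by (simp add: w_def del: right_diff_distrib_numeral)
          moreover have "m \<le> w" "w < m + 1"
            unfolding m_def w_def[symmetric] by linarith+
          ultimately show ?thesis
            unfolding eq by linarith
        qed
        then have "t (Suc k) * \<bar>y' - y\<bar> \<le> 24"
          using tpos[of "Suc k"] by (simp add: abs_mult flip: right_diff_distrib)
        moreover have "200 * t k * \<bar>y' - y\<bar> \<le> t (Suc k) * \<bar>y' - y\<bar>"
          using grow by (intro mult_right_mono) auto
        ultimately have "\<bar>y' - y\<bar> \<le> 1 / (8 * t k)"
          using tpos[of k] by (simp add: field_simps)
        with eq show "\<exists>y'. ?hit (Suc k) y' \<and> \<bar>y' - y\<bar> \<le> 1 / (8 * t k)"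
          by blast
      qed
      with that show thesis by blast
    qed
    obtain z where "y \<longlonglongrightarrow> z" and z: "\<And>k. \<bar>t k * z - t k * y k\<bar> \<le> 1 / 4"
      using geometric_steps_converge[of t "1 / 4" y] tpos t2 y(2) by auto
    have "t k * z \<in> A (k \<in> i)" "t k * (x - z) \<in> A (k \<in> j)" for k
    proof -
      obtain m :: int where m: "t k * y k = a k + 24 * real_of_int m"
        using y by blast
      have "\<bar>t k * z - real_of_int (a k + 24 * m)\<bar> \<le> 3 / 4"
        using z[of k] m by simp
      then show "t k * z \<in> A (k \<in> i)"
        using a[of k] digit_set_mod[OF a[of k]] by (intro A_I[of "a k + 24 * m"]) auto
      \<comment> \<open>The integer near \<open>t k * (x - z)\<close>: rounding contributes 1/2 and
        passing from \<open>y k\<close> to \<open>z\<close> contributes 1/4.\<close>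
      let ?c = "round (t k * x) - a k - 24 * m"
      have "?c mod 24 = (round (t k * x) - a k) mod 24"
        by (metis mod_mult_self2 minus_mult_right diff_conv_add_uminus)
      also have "\<dots> = b k mod 24"
        using mod_diff_cong[OF ab[of k] refl, of "a k"] by simp
      finally have "?c mod 24 = b k"
        using digit_set_mod[OF b[of k]] by simp
      moreover have "\<bar>real_of_int (round (t k * x)) - t k * x\<bar> \<le> 1 / 2"
        by (rule of_int_round_abs_le)
      then have "\<bar>t k * (x - z) - real_of_int ?c\<bar> \<le> 3 / 4"
        using z[of k] m unfolding right_diff_distrib of_int_diff of_int_mult of_int_numeral by linarith
      ultimately show "t k * (x - z) \<in> A (k \<in> j)"
        using b[of k] by (intro A_I[of ?c]) auto
    qed
    then show ?thesis
      by (auto simp: D_def)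
  qed
  ultimately show thesis
    using that disj closed_D by blast
qed

section \<open>Reduction to one coordinate\<close>

text \<open>Otherwise every portion of \<open>P\<close> contains a smaller one on which a prescribed
  coordinate is constant. Treating the finitely many coordinates in turn leaves a portion with a
  single point, which would be isolated.\<close>

lemma perfect_coordinate_nonconstant:
  fixes P :: "(real ^ 'n) set"
  assumes "P \<noteq> {}" and lim: "\<And>x. x \<in> P \<Longrightarrow> x islimpt P"
  obtains k U where "open U" and "P \<inter> U \<noteq> {}"
    and "\<And>V. open V \<Longrightarrow> V \<subseteq> U \<Longrightarrow> P \<inter> V \<noteq> {} \<Longrightarrow> \<exists>x\<in>P \<inter> V. \<exists>y\<in>P \<inter> V. x $ k \<noteq> y $ k"
proof (rule ccontr)
  note witness = that
  assume neg: "\<not> thesis"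
  have "\<exists>U. open U \<and> P \<inter> U \<noteq> {} \<and> (\<forall>k\<in>I. \<forall>x\<in>P \<inter> U. \<forall>y\<in>P \<inter> U. x $ k = y $ k)" for I :: "'n set"
  proof (induction I rule: infinite_finite_induct)
    case empty
    show ?case using assms(1) by (intro exI[of _ UNIV]) auto
  next
    case (insert k I)
    then obtain U where U: "open U" "P \<inter> U \<noteq> {}"
      "\<forall>k\<in>I. \<forall>x\<in>P \<inter> U. \<forall>y\<in>P \<inter> U. x $ k = y $ k" by blast
    then obtain V where "open V" "V \<subseteq> U" "P \<inter> V \<noteq> {}" "\<forall>x\<in>P \<inter> V. \<forall>y\<in>P \<inter> V. x $ k = y $ k"
      using neg witness[of U k] by blast
    with U show ?case by (intro exI[of _ V]) blast
  qed simp
  from this[of UNIV] obtain U where U: "open U" "P \<inter> U \<noteq> {}"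
    and "\<forall>x\<in>P \<inter> U. \<forall>y\<in>P \<inter> U. x = y"
    unfolding vec_eq_iff by blast
  then obtain x where "x \<in> P" "x \<in> U" "\<And>y. y \<in> P \<Longrightarrow> y \<in> U \<Longrightarrow> y = x"
    by blast
  then show False
    using lim[of x] \<open>open U\<close> unfolding islimpt_def by blast
qed

text \<open>\<open>K\<close> is the projection of the closure of a bounded portion on which
  coordinate \<open>k\<close> is nowhere locally constant: boundedness gives compactness, and
  nonconstancy excludes isolated points.\<close>

lemma perfect_coordinate_projection:
  fixes P :: "(real ^ 'n) set"
  assumes "P \<noteq> {}" and "closed_perfect P"
  obtains k K where "compact K" and "K \<noteq> {}" and "K \<subseteq> (\<lambda>x. x $ k) ` P"
    and "\<And>p. p \<in> K \<Longrightarrow> p islimpt K"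
proof -
  have "closed P" and lim: "\<And>x. x \<in> P \<Longrightarrow> x islimpt P"
    using assms(2) by (auto simp: closed_perfect_def isolated_in_islimpt_iff)
  obtain k U where U: "open U" "P \<inter> U \<noteq> {}" and nonconst:
    "\<And>V. open V \<Longrightarrow> V \<subseteq> U \<Longrightarrow> P \<inter> V \<noteq> {} \<Longrightarrow> \<exists>x\<in>P \<inter> V. \<exists>y\<in>P \<inter> V. x $ k \<noteq> y $ k"
    using perfect_coordinate_nonconstant[OF assms(1) lim] by metis
  then obtain x0 where x0: "x0 \<in> P" "x0 \<in> U" by blast
  define W where "W = U \<inter> ball x0 1"
  define L where "L = closure (P \<inter> W)"
  define K where "K = (\<lambda>x. x $ k) ` L"
  have W: "open W" "W \<subseteq> U" "x0 \<in> W"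
    using U x0 by (auto simp: W_def)
  have "bounded (P \<inter> W)"
    by (rule bounded_subset[of "ball x0 1"]) (auto simp: W_def)
  then have "compact L"
    by (simp add: L_def compact_closure)
  then have "compact K"
    unfolding K_def by (intro compact_continuous_image continuous_intros)
  moreover have "K \<noteq> {}"
    using x0 W by (auto simp: K_def L_def)
  moreover have "L \<subseteq> P"
    unfolding L_def using \<open>closed P\<close> by (intro closure_minimal) auto
  then have "K \<subseteq> (\<lambda>x. x $ k) ` P"
    by (auto simp: K_def)
  moreover have "p islimpt K" if "p \<in> K" for p
    unfolding islimpt_approachable
  proof (intro allI impI)
    fix e :: real assume "e > 0"
    obtain z where z: "z \<in> L" "p = z $ k"
      using \<open>p \<in> K\<close> by (auto simp: K_def)
    \<comment> \<open>The point \<open>z\<close> may lie only in the closure, so a nearby point of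
      \<open>P \<inter> W\<close> shows that the piece near \<open>z\<close> is nonempty.\<close>
    then obtain w where "w \<in> P \<inter> W" "dist w z < e"
      using \<open>e > 0\<close> unfolding L_def closure_approachable by blast
    then have "P \<inter> (W \<inter> ball z e) \<noteq> {}"
      by (auto simp: dist_commute)
    moreover have "open (W \<inter> ball z e)"
      using W by auto
    ultimately obtain x y where xy: "x \<in> P \<inter> (W \<inter> ball z e)" "y \<in> P \<inter> (W \<inter> ball z e)" "x $ k \<noteq> y $ k"
      using nonconst[of "W \<inter> ball z e"] W by blast
    \<comment> \<open>Of two points with different \<open>k\<close>-th coordinates, at least one has
      a coordinate other than \<open>p\<close>.\<close>
    then obtain u where u: "u \<in> P \<inter> (W \<inter> ball z e)" "u $ k \<noteq> p"
      by metis
    then have "u \<in> L"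
      using closure_subset[of "P \<inter> W"] by (auto simp: L_def)
    moreover have "dist (u $ k) p < e"
      using dist_vec_nth_le[of u k z] u z by (simp add: dist_commute)
    ultimately show "\<exists>x'\<in>K. x' \<noteq> p \<and> dist x' p < e"
      using u by (auto simp: K_def)
  qed
  ultimately show thesis
    using that by blast
qed

theorem theorem1p5:
  fixes P :: "(real ^ 'n) set"
  assumes "P \<noteq> {}" and "closed_perfect P"
  shows "\<exists>C :: nat set \<Rightarrow> (real ^ 'n) set.
    disjoint_family C \<and> (\<forall>i. closed (C i)) \<and>
    (\<forall>i. P + C i = UNIV) \<and> (\<forall>i j. C i + C j = UNIV)"
proof -
  obtain K k where K: "compact K" "K \<noteq> {}" "K \<subseteq> (\<lambda>x. x $ k) ` P" "\<And>p. p \<in> K \<Longrightarrow> p islimpt K"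
    by (rule perfect_coordinate_projection[OF assms]) (rule that; assumption)
  obtain D :: "nat set \<Rightarrow> real set" where D: "disjoint_family D" "\<And>i. closed (D i)"
    and KD: "\<And>x i. \<exists>p\<in>K. x - p \<in> D i" and DD: "\<And>x i j. \<exists>y\<in>D i. x - y \<in> D j"
    by (rule real_disjoint_family[OF K(1,2)]) ((rule K(4) | rule that); assumption)+
  \<comment> \<open>Cylinders constrain coordinate \<open>k\<close> alone, so closedness,
    disjointness and both sum properties lift from the real line.\<close>
  define C where "C i = (\<lambda>x::real^'n. x $ k) -` D i" for i
  have "disjoint_family C"
    using D(1) by (auto simp: disjoint_family_on_def C_def)
  moreover have "closed (C i)" for i
    unfolding C_def by (intro closed_vimage D continuous_intros)
  moreover have "x \<in> P + C i" for x i
  proof -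
    obtain p where p: "p \<in> P" "x $ k - p $ k \<in> D i"
      using KD[of "x $ k" i] K(3) by blast
    then have "p + (x - p) \<in> P + C i"
      by (intro set_plus_intro) (auto simp: C_def)
    then show ?thesis by simp
  qed
  moreover have "x \<in> C i + C j" for x i j
  proof -
    obtain y where y: "y \<in> D i" "x $ k - y \<in> D j"
      using DD by blast
    \<comment> \<open>Any vector with \<open>k\<close>-th coordinate \<open>y\<close> would serve;
      the constant vector is a convenient one.\<close>
    then have "vec y + (x - vec y) \<in> C i + C j"
      by (intro set_plus_intro) (auto simp: C_def)
    then show ?thesis by simp
  qed
  ultimately show ?thesis
    by (intro exI[of _ C]) blast
qed

end
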